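(* Let $A^i_j$ and $\Gamma^j_{rs}$ ($i,j,r,s=1,\dots,n$) be functions of $y=(y^1,\ldots,y^n)$ with $\det A\neq 0$, where $A=(A^i_j)$, and consider the system $$\frac{\partial y^i}{\partial t}=\sum_{j=1}^n A^i_j\left(\frac{\partial^2 y^j}{\partial x^2}+\sum_{r=1}^n\sum_{s=1}^n\Gamma^j_{rs}\,\frac{\partial y^r}{\partial x}\,\frac{\partial y^s}{\partial x}\right),\qquad i=1,\dots,n,$$ for functions $y^i=y^i(t,x)$. Let $\tilde y^i=\tilde y^i(y^1,\ldots,y^n)$, $i=1,\dots,n$, be an invertible (local) change of variables (point transformation), and put $S^i_j=\partial y^i/\partial\tilde y^j$, $T^i_j=\partial\tilde y^i/\partial y^j$. Then under this point transformation the system transfers to a system of the same form $$\frac{\partial\tilde y^i}{\partial t}=\sum_{j=1}^n\tilde A^i_j\left(\frac{\partial^2\tilde y^j}{\partial x^2}+\sum_{r=1}^n\sum_{s=1}^n\tilde\Gamma^j_{rs}\,\frac{\partial\tilde y^r}{\partial x}\,\frac{\partial\tilde y^s}{\partial x}\right),\qquad i=1,\dots,n,$$ where the coefficients of the two systems are related by $$A^k_i=\sum_{m=1}^n\sum_{p=1}^n S^k_m\,T^p_i\,\tilde A^m_p,$$ $$\Gamma^k_{ij}=\sum_{m=1}^n\sum_{p=1}^n\sum_{q=1}^n S^k_m\,T^p_i\,T^q_j\,\tilde\Gamma^m_{pq}+\sum_{m=1}^n S^k_m\,\frac{\partial T^m_i}{\partial y^j}.$$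
   Context: All functions and changes of variables are assumed smooth; a change of variables is a local diffeomorphism $y\mapsto\tilde y$ of (open subsets of) $\mathbb{R}^n$, so $S=T^{-1}$ at corresponding points. The coefficients $\tilde A^i_j$, $\tilde\Gamma^j_{rs}$ are functions of $\tilde y$, and the relations between coefficients are understood at corresponding points. *)

theory Defs
  imports "HOL-Analysis.Analysis"
begin

text \<open>On an open subset of a Euclidean space, a function is \<open>C\<^sup>k\<close> iff all its iterated directional
  derivatives up to order \<open>k\<close> exist, with total differentiability at each step up to \<open>k - 1\<close> and
  continuity of the last ones. All predicates below are meant for open domains only: outside the
  domain the functions are arbitrary.\<close>

primrec C_diff_on :: "nat \<Rightarrow> 'a::euclidean_space set \<Rightarrow> ('a \<Rightarrow> 'b::euclidean_space) \<Rightarrow> bool" where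
  "C_diff_on 0 U f \<longleftrightarrow> continuous_on U f"
| "C_diff_on (Suc k) U f \<longleftrightarrow>
     (\<forall>x\<in>U. f differentiable (at x)) \<and>
     (\<forall>v. C_diff_on k U (\<lambda>x. frechet_derivative f (at x) v))"

definition smooth_on :: "'a::euclidean_space set \<Rightarrow> ('a \<Rightarrow> 'b::euclidean_space) \<Rightarrow> bool" where
  "smooth_on U f \<longleftrightarrow> (\<forall>k. C_diff_on k U f)"

definition change_of_variables ::
    "(real^'n) set \<Rightarrow> (real^'n) set \<Rightarrow> (real^'n \<Rightarrow> real^'n) \<Rightarrow> (real^'n \<Rightarrow> real^'n) \<Rightarrow> bool" where
  "change_of_variables U V \<phi> \<psi> \<longleftrightarrow>
     open U \<and> open V \<and> homeomorphism U V \<phi> \<psi> \<and> smooth_on U \<phi> \<and> smooth_on V \<psi>"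

definition pderiv_at :: "(real^'n \<Rightarrow> real) \<Rightarrow> 'n \<Rightarrow> real^'n \<Rightarrow> real" where
  "pderiv_at f j y = frechet_derivative f (at y) (axis j 1)"

text \<open>Index conventions: \<open>A y $ i $ j\<close> is \<open>A\<^sup>i\<^sub>j\<close> and \<open>\<Gamma> y $ j $ r $ s\<close> is
  \<open>\<Gamma>\<^sup>j\<^sub>r\<^sub>s\<close>, both at the point \<open>y\<close>; no symmetry of \<open>\<Gamma>\<close> in its
  lower indices is required.\<close>

definition admissible_coefficients ::
    "(real^'n) set \<Rightarrow> (real^'n \<Rightarrow> real^'n^'n) \<Rightarrow> (real^'n \<Rightarrow> real^'n^'n^'n) \<Rightarrow> bool" where
  "admissible_coefficients U A \<Gamma> \<longleftrightarrow>
     smooth_on U A \<and> smooth_on U \<Gamma> \<and> (\<forall>y\<in>U. det (A y) \<noteq> 0)"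

definition system_holds_at ::
    "(real^'n \<Rightarrow> real^'n^'n) \<Rightarrow> (real^'n \<Rightarrow> real^'n^'n^'n) \<Rightarrow> (real \<times> real \<Rightarrow> real^'n) \<Rightarrow>
     real \<Rightarrow> real \<Rightarrow> bool" where
  "system_holds_at A \<Gamma> y t x \<longleftrightarrow>
     (\<forall>i. deriv (\<lambda>\<tau>. y (\<tau>, x) $ i) t =
       (\<Sum>j\<in>UNIV. A (y (t, x)) $ i $ j *
         ((deriv ^^ 2) (\<lambda>\<xi>. y (t, \<xi>) $ j) x +
          (\<Sum>r\<in>UNIV. \<Sum>s\<in>UNIV. \<Gamma> (y (t, x)) $ j $ r $ s *
             deriv (\<lambda>\<xi>. y (t, \<xi>) $ r) x * deriv (\<lambda>\<xi>. y (t, \<xi>) $ s) x))))"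

text \<open>The equivalence of the two systems is required at every single point, for every smooth function
  and not just for solutions. Hence \<open>y\<close> solves the first system on an open set \<open>W\<close> iff \<open>\<phi> \<circ> y\<close>
  solves the second one there, but the notion does not degenerate when a system has few solutions.\<close>

definition system_transfers ::
    "(real^'n) set \<Rightarrow> (real^'n \<Rightarrow> real^'n) \<Rightarrow>
     (real^'n \<Rightarrow> real^'n^'n) \<Rightarrow> (real^'n \<Rightarrow> real^'n^'n^'n) \<Rightarrow>
     (real^'n \<Rightarrow> real^'n^'n) \<Rightarrow> (real^'n \<Rightarrow> real^'n^'n^'n) \<Rightarrow> bool" where
  "system_transfers U \<phi> A \<Gamma> A' \<Gamma>' \<longleftrightarrow>
     (\<forall>W y. open W \<and> smooth_on W y \<and> y ` W \<subseteq> U \<longrightarrow>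
       (\<forall>(t, x)\<in>W. system_holds_at A \<Gamma> y t x \<longleftrightarrow> system_holds_at A' \<Gamma>' (\<phi> \<circ> y) t x))"

end

theory Submission
  imports Defs
begin

text \<open>By the chain rule, \<open>u = \<phi> \<circ> y\<close> satisfies \<open>u\<^sub>t = T y\<^sub>t\<close>,
  \<open>u\<^sub>x = T y\<^sub>x\<close> and \<open>u\<^sub>x\<^sub>x = T y\<^sub>x\<^sub>x + (\<partial>T)(y\<^sub>x, y\<^sub>x)\<close>. The two relations between the
  coefficients can be solved for the new ones since \<open>S T = 1\<close>, and they turn
  \<open>S A' (u\<^sub>x\<^sub>x + \<Gamma>'(u\<^sub>x, u\<^sub>x))\<close> into \<open>A (y\<^sub>x\<^sub>x + \<Gamma>(y\<^sub>x, y\<^sub>x))\<close>. So the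
  new system at a point is the old one multiplied by the invertible matrix \<open>T\<close>.\<close>

section \<open>Smooth functions\<close>

text \<open>On an open set the relation \<open>has_derivative\<close> at a point depends only on the
  values inside the set. Since \<open>frechet_derivative\<close> is a choice among such derivatives,
  equal relations give equal choices, and the induction can pass to the derivatives.\<close>

lemma C_diff_on_cong:
  assumes "open U" "\<And>x. x \<in> U \<Longrightarrow> f x = g x"
  shows "C_diff_on k U f \<longleftrightarrow> C_diff_on k U g"
  using assms(2)
proof (induction k arbitrary: f g)
  case 0
  then show ?case using continuous_on_cong by force
next
  case (Suc k)
  have der: "(f has_derivative D) (at x) \<longleftrightarrow> (g has_derivative D) (at x)" if "x \<in> U" for D x
    using has_derivative_transform_within_open[OF _ assms(1) that, of f D UNIV g]
      has_derivative_transform_within_open[OF _ assms(1) that, of g D UNIV f] Suc.prems by auto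
  have fd: "frechet_derivative f (at x) = frechet_derivative g (at x)" if "x \<in> U" for x
    unfolding frechet_derivative_def using der[OF that] by simp
  have "f differentiable (at x) \<longleftrightarrow> g differentiable (at x)" if "x \<in> U" for x
    unfolding differentiable_def using der[OF that] by simp
  moreover have "C_diff_on k U (\<lambda>x. frechet_derivative f (at x) v)
      \<longleftrightarrow> C_diff_on k U (\<lambda>x. frechet_derivative g (at x) v)" for v
    by (rule Suc.IH) (simp add: fd)
  ultimately show ?case by simp
qed

text \<open>The recursive clause speaks of the derivatives of \<open>f\<close> only, so lowering the
  order is an induction; its base is that differentiability implies continuity.\<close>

lemma C_diff_on_Suc_imp: "C_diff_on (Suc k) U f \<Longrightarrow> C_diff_on k U f"
proof (induction k arbitrary: f)
  case 0
  then show ?case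
    by (auto intro!: continuous_at_imp_continuous_on differentiable_imp_continuous_within)
next
  case (Suc k)
  show ?case
    unfolding C_diff_on.simps(2)[of k]
    using Suc.prems Suc.IH unfolding C_diff_on.simps(2)[of "Suc k"] by blast
qed

lemma C_diff_on_const: "C_diff_on k U (\<lambda>x. c)"
  by (induction k arbitrary: c) auto

text \<open>Allows an explicit formula \<open>D\<close> in place of the chosen
  \<open>frechet_derivative\<close>. The closure properties below follow from it by inserting the
  sum, product or chain rule.\<close>

lemma C_diff_on_Suc_has_derivative:
  assumes "open U" "\<And>x. x \<in> U \<Longrightarrow> (f has_derivative D x) (at x)"
    and "\<And>v. C_diff_on k U (\<lambda>x. D x v)"
  shows "C_diff_on (Suc k) U f"
proof -
  have "frechet_derivative f (at x) v = D x v" if "x \<in> U" for x v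
    using frechet_derivative_at[OF assms(2)[OF that]] by simp
  then have "C_diff_on k U (\<lambda>x. frechet_derivative f (at x) v)" for v
    using C_diff_on_cong[OF assms(1), of "\<lambda>x. frechet_derivative f (at x) v" "\<lambda>x. D x v" k] assms(3)
    by simp
  with assms(2) show ?thesis by (auto simp: differentiable_def)
qed

lemma C_diff_on_Suc_derivative:
  assumes "C_diff_on (Suc k) U f" "x \<in> U"
  shows "(f has_derivative frechet_derivative f (at x)) (at x)"
  using assms by (simp add: frechet_derivative_works)

lemma C_diff_on_linear:
  assumes "bounded_linear h" "open U" "C_diff_on k U f"
  shows "C_diff_on k U (\<lambda>x. h (f x))"
  using assms(3)
proof (induction k arbitrary: f)
  case 0
  then show ?case using bounded_linear.continuous_on[OF assms(1)] by simp
next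
  case (Suc k)
  show ?case
  proof (rule C_diff_on_Suc_has_derivative[OF assms(2)])
    show "((\<lambda>x. h (f x)) has_derivative (\<lambda>v. h (frechet_derivative f (at x) v))) (at x)"
      if "x \<in> U" for x
      by (rule bounded_linear.has_derivative[OF assms(1) C_diff_on_Suc_derivative[OF Suc.prems that]])
    show "C_diff_on k U (\<lambda>x. h (frechet_derivative f (at x) v))" for v
      by (rule Suc.IH) (use Suc.prems in simp)
  qed
qed

lemma C_diff_on_add:
  assumes "open U" "C_diff_on k U f" "C_diff_on k U g"
  shows "C_diff_on k U (\<lambda>x. f x + g x)"
  using assms(2,3)
proof (induction k arbitrary: f g)
  case 0
  then show ?case by (auto intro: continuous_on_add)
next
  case (Suc k)
  show ?case
  proof (rule C_diff_on_Suc_has_derivative[OF assms(1)])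
    show "((\<lambda>x. f x + g x) has_derivative
        (\<lambda>v. frechet_derivative f (at x) v + frechet_derivative g (at x) v)) (at x)"
      if "x \<in> U" for x
      by (intro has_derivative_add C_diff_on_Suc_derivative[OF Suc.prems(1) that]
          C_diff_on_Suc_derivative[OF Suc.prems(2) that])
    show "C_diff_on k U (\<lambda>x. frechet_derivative f (at x) v + frechet_derivative g (at x) v)" for v
      by (rule Suc.IH) (use Suc.prems in simp_all)
  qed
qed

lemma C_diff_on_sum:
  assumes "open U" "\<And>i. i \<in> I \<Longrightarrow> C_diff_on k U (f i)"
  shows "C_diff_on k U (\<lambda>x. \<Sum>i\<in>I. f i x)"
proof (cases "finite I")
  case True
  then show ?thesis using assms(2)
    by (induction I rule: finite_induct) (simp_all add: C_diff_on_const C_diff_on_add[OF assms(1)])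
qed (simp add: C_diff_on_const)

text \<open>The product rule yields two terms of the same bilinear shape, each pairing one function
  with a derivative of the other. The induction therefore varies both functions, and the
  undifferentiated one is lowered by one order.\<close>

lemma C_diff_on_bilinear:
  assumes "bounded_bilinear h" "open U" "C_diff_on k U f" "C_diff_on k U g"
  shows "C_diff_on k U (\<lambda>x. h (f x) (g x))"
  using assms(3,4)
proof (induction k arbitrary: f g)
  case 0
  then show ?case using bounded_bilinear.continuous_on[OF assms(1)] by simp
next
  case (Suc k)
  show ?case
  proof (rule C_diff_on_Suc_has_derivative[OF assms(2)])
    show "((\<lambda>x. h (f x) (g x)) has_derivative
        (\<lambda>v. h (f x) (frechet_derivative g (at x) v) + h (frechet_derivative f (at x) v) (g x))) (at x)"
      if "x \<in> U" for x
      by (rule bounded_bilinear.FDERIV[OF assms(1) C_diff_on_Suc_derivative[OF Suc.prems(1) that]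
          C_diff_on_Suc_derivative[OF Suc.prems(2) that]])
    show "C_diff_on k U (\<lambda>x. h (f x) (frechet_derivative g (at x) v) +
        h (frechet_derivative f (at x) v) (g x))" for v
      using Suc.prems C_diff_on_Suc_imp[OF Suc.prems(1)] C_diff_on_Suc_imp[OF Suc.prems(2)]
      by (intro C_diff_on_add[OF assms(2)] Suc.IH) simp_all
  qed
qed

text \<open>In the chain rule the outer derivative is taken in a direction that moves with
  \<open>x\<close>, whereas \<open>C_diff_on\<close> fixes the direction. Expanding that direction
  in \<open>Basis\<close> leaves a finite sum of scalar coefficients times outer derivatives in
  fixed directions, to which the induction hypothesis applies.\<close>

lemma C_diff_on_compose:
  assumes "open U" "C_diff_on k U g" "C_diff_on k V f" "g ` U \<subseteq> V"
  shows "C_diff_on k U (\<lambda>x. f (g x))"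
  using assms(2,3)
proof (induction k arbitrary: f)
  case 0
  then show ?case using assms(4) by (auto intro: continuous_on_compose2)
next
  case (Suc k)
  let ?D = "\<lambda>x v. \<Sum>b\<in>Basis. (frechet_derivative g (at x) v \<bullet> b) *\<^sub>R frechet_derivative f (at (g x)) b"
  show ?case
  proof (rule C_diff_on_Suc_has_derivative[OF assms(1)])
    fix x assume x: "x \<in> U"
    then have "g x \<in> V" using assms(4) by auto
    note f = C_diff_on_Suc_derivative[OF Suc.prems(2) this]
    have expand: "frechet_derivative f (at (g x)) w =
        (\<Sum>b\<in>Basis. (w \<bullet> b) *\<^sub>R frechet_derivative f (at (g x)) b)" for w
    proof -
      have "frechet_derivative f (at (g x)) w =
          frechet_derivative f (at (g x)) (\<Sum>b\<in>Basis. (w \<bullet> b) *\<^sub>R b)"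
        by (simp add: euclidean_representation)
      also have "\<dots> = (\<Sum>b\<in>Basis. (w \<bullet> b) *\<^sub>R frechet_derivative f (at (g x)) b)"
        using has_derivative_linear[OF f] by (simp add: linear_sum linear_cmul)
      finally show ?thesis .
    qed
    have "((\<lambda>x. f (g x)) has_derivative
        (\<lambda>v. frechet_derivative f (at (g x)) (frechet_derivative g (at x) v))) (at x)"
      using has_derivative_compose[OF C_diff_on_Suc_derivative[OF Suc.prems(1) x] f] .
    then show "((\<lambda>x. f (g x)) has_derivative ?D x) (at x)"
      unfolding expand[of "frechet_derivative g (at x) _"] .
  next
    fix v
    have "C_diff_on k U (\<lambda>x. frechet_derivative g (at x) v \<bullet> b)" for b
      by (rule C_diff_on_linear[OF bounded_linear_inner_left assms(1)]) (use Suc.prems in simp)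
    moreover have "C_diff_on k U (\<lambda>x. frechet_derivative f (at (g x)) b)" for b
      by (rule Suc.IH[OF C_diff_on_Suc_imp[OF Suc.prems(1)]]) (use Suc.prems in simp)
    ultimately show "C_diff_on k U (\<lambda>x. ?D x v)"
      by (intro C_diff_on_sum[OF assms(1)] C_diff_on_bilinear[OF bounded_bilinear_scaleR assms(1)])
  qed
qed

section \<open>Closure properties of smooth functions\<close>

lemma smooth_on_const: "smooth_on U (\<lambda>x. c)"
  by (simp add: smooth_on_def C_diff_on_const)

lemma smooth_on_linear:
  "bounded_linear h \<Longrightarrow> open U \<Longrightarrow> smooth_on U f \<Longrightarrow> smooth_on U (\<lambda>x. h (f x))"
  by (simp add: smooth_on_def C_diff_on_linear)

lemma smooth_on_sum:
  "open U \<Longrightarrow> (\<And>i. i \<in> I \<Longrightarrow> smooth_on U (f i)) \<Longrightarrow> smooth_on U (\<lambda>x. \<Sum>i\<in>I. f i x)"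
  by (simp add: smooth_on_def C_diff_on_sum)

lemma smooth_on_bilinear:
  "bounded_bilinear h \<Longrightarrow> open U \<Longrightarrow> smooth_on U f \<Longrightarrow> smooth_on U g \<Longrightarrow> smooth_on U (\<lambda>x. h (f x) (g x))"
  by (simp add: smooth_on_def C_diff_on_bilinear)

lemma smooth_on_compose:
  assumes "open U" "smooth_on U g" "smooth_on V f" "g ` U \<subseteq> V"
  shows "smooth_on U (\<lambda>x. f (g x))"
  using assms C_diff_on_compose[of U _ g V f] by (simp add: smooth_on_def)

lemma smooth_on_frechet_derivative:
  assumes "smooth_on U f"
  shows "smooth_on U (\<lambda>x. frechet_derivative f (at x) v)"
  unfolding smooth_on_def
proof
  fix k
  have "C_diff_on (Suc k) U f" using assms by (simp only: smooth_on_def)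
  then show "C_diff_on k U (\<lambda>x. frechet_derivative f (at x) v)" by simp
qed

lemma smooth_on_has_derivative:
  assumes "smooth_on U f" "x \<in> U"
  shows "(f has_derivative frechet_derivative f (at x)) (at x)"
proof -
  have "C_diff_on (Suc 0) U f" using assms(1) by (simp only: smooth_on_def)
  then show ?thesis using assms(2) by (rule C_diff_on_Suc_derivative)
qed

lemma bounded_linear_axis: "bounded_linear (axis i :: 'a::euclidean_space \<Rightarrow> 'a^'n)"
  by (rule linear_conv_bounded_linear[THEN iffD1], rule linearI)
    (auto simp: axis_def vec_eq_iff)

text \<open>A vector is the sum of its components placed on the axes, and each placement is linear.
  Applied repeatedly, this reduces smoothness of matrices and of three-index arrays to their
  entries.\<close>

lemma smooth_on_vec:
  fixes f :: "'a::euclidean_space \<Rightarrow> 'b::euclidean_space^'n"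
  assumes "open U" "\<And>i. smooth_on U (\<lambda>x. f x $ i)"
  shows "smooth_on U f"
proof -
  have "smooth_on U (\<lambda>x. \<Sum>i\<in>UNIV. axis i (f x $ i))"
    by (intro smooth_on_sum smooth_on_linear[OF bounded_linear_axis] assms)
  also have "(\<lambda>x. \<Sum>i\<in>UNIV. axis i (f x $ i)) = f"
    by (rule ext) (simp add: vec_eq_iff axis_def)
  finally show ?thesis .
qed

lemma smooth_on_nth: "open U \<Longrightarrow> smooth_on U f \<Longrightarrow> smooth_on U (\<lambda>x. f x $ i)"
  by (rule smooth_on_linear[OF bounded_linear_vec_nth])

lemma smooth_on_minus:
  assumes "open U" "smooth_on U f" "smooth_on U g"
  shows "smooth_on U (\<lambda>x. f x - g x)"
proof -
  have "smooth_on U (\<lambda>x. - g x)"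
    by (rule smooth_on_linear[OF bounded_linear_minus[OF bounded_linear_ident] assms(1,3)])
  then have "smooth_on U (\<lambda>x. f x + - g x)"
    using assms unfolding smooth_on_def by (intro allI C_diff_on_add) simp_all
  then show ?thesis by simp
qed

section \<open>Matrix operations as bounded linear and bilinear maps\<close>

lemma bounded_bilinear_matrix_mult:
  "bounded_bilinear ((**) :: real^'n^'m \<Rightarrow> real^'p^'n \<Rightarrow> real^'p^'m)"
  unfolding bilinear_conv_bounded_bilinear[symmetric] bilinear_def linear_iff
  by (auto simp: vec_eq_iff matrix_matrix_mult_def sum.distrib algebra_simps sum_distrib_left)

lemma bounded_bilinear_matrix_vector_mult:
  "bounded_bilinear ((*v) :: real^'n^'m \<Rightarrow> real^'n \<Rightarrow> real^'m)"
  unfolding bilinear_conv_bounded_bilinear[symmetric] bilinear_def linear_iff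
  by (auto simp: vec_eq_iff matrix_vector_mult_def sum.distrib algebra_simps sum_distrib_left)

lemma bounded_linear_transpose: "bounded_linear (transpose :: real^'n^'m \<Rightarrow> real^'m^'n)"
  unfolding linear_conv_bounded_linear[symmetric] linear_iff
  by (auto simp: vec_eq_iff transpose_def)

section \<open>Quadratic terms and their transformation\<close>

definition quadratic_form :: "real^'n^'n^'n \<Rightarrow> real^'n \<Rightarrow> real^'n" where
  "quadratic_form \<Gamma> v = (\<chi> j. v \<bullet> (\<Gamma> $ j *v v))"

text \<open>The tensorial part of the law for \<open>\<Gamma>\<close>: the upper index is contracted
  with \<open>M\<close>, both lower ones with \<open>N\<close>. With \<open>N = mat 1\<close> only
  the upper index changes, which is the shape of the inhomogeneous term.\<close>

definition tensor_transform :: "real^'n^'n \<Rightarrow> real^'n^'n \<Rightarrow> real^'n^'n^'n \<Rightarrow> real^'n^'n^'n" where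
  "tensor_transform M N \<Gamma> = (\<chi> k. \<Sum>m\<in>UNIV. M $ k $ m *\<^sub>R (transpose N ** \<Gamma> $ m ** N))"

lemma quadratic_form_nth:
  "quadratic_form \<Gamma> v $ j = (\<Sum>r\<in>UNIV. \<Sum>s\<in>UNIV. \<Gamma> $ j $ r $ s * v $ r * v $ s)"
  by (simp add: quadratic_form_def inner_vec_def matrix_vector_mult_def sum_distrib_left mult_ac)

lemma quadratic_form_add:
  "quadratic_form (\<Gamma> + \<Delta>) v = quadratic_form \<Gamma> v + quadratic_form \<Delta> v"
  by (simp add: quadratic_form_def vec_eq_iff matrix_vector_mult_add_rdistrib inner_add_right)

lemma tensor_transform_nth:
  "tensor_transform M N \<Gamma> $ k $ i $ j =
    (\<Sum>m\<in>UNIV. \<Sum>p\<in>UNIV. \<Sum>q\<in>UNIV. M $ k $ m * N $ p $ i * N $ q $ j * \<Gamma> $ m $ p $ q)"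
proof -
  have "(transpose N ** \<Gamma> $ m ** N) $ i $ j =
      (\<Sum>p\<in>UNIV. \<Sum>q\<in>UNIV. N $ p $ i * N $ q $ j * \<Gamma> $ m $ p $ q)" for m
    unfolding matrix_matrix_mult_def transpose_def
    by (simp add: sum_distrib_right sum_distrib_left, subst sum.swap) (simp add: mult_ac)
  then show ?thesis
    by (simp add: tensor_transform_def sum_distrib_left mult_ac)
qed

lemma tensor_transform_mat1_nth:
  "tensor_transform M (mat 1) \<Gamma> $ k $ i $ j = (\<Sum>m\<in>UNIV. M $ k $ m * \<Gamma> $ m $ i $ j)"
  by (simp add: tensor_transform_def)

text \<open>The congruence by \<open>N\<close> is linear, so it passes through the inner sum;
  transposition reverses products, whence \<open>N' ** N\<close>. Mutually inverse matrices thus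
  give inverse transformations.\<close>

lemma tensor_transform_comp:
  "tensor_transform M N (tensor_transform M' N' \<Gamma>) =
    tensor_transform (M ** M') (N' ** N) \<Gamma>"
proof -
  interpret r: bounded_linear "\<lambda>A. transpose N ** A ** N"
    by (intro bounded_linear_compose[OF bounded_bilinear.bounded_linear_left[OF bounded_bilinear_matrix_mult]]
        bounded_bilinear.bounded_linear_right[OF bounded_bilinear_matrix_mult])
  have "tensor_transform M N (tensor_transform M' N' \<Gamma>) $ k =
      tensor_transform (M ** M') (N' ** N) \<Gamma> $ k" for k
  proof -
    let ?G = "\<lambda>l. transpose (N' ** N) ** \<Gamma> $ l ** (N' ** N)"
    have "transpose N ** tensor_transform M' N' \<Gamma> $ m ** N = (\<Sum>l\<in>UNIV. M' $ m $ l *\<^sub>R ?G l)" for m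
      by (simp add: tensor_transform_def r.sum r.scaleR matrix_transpose_mul matrix_mul_assoc)
    then have "tensor_transform M N (tensor_transform M' N' \<Gamma>) $ k =
        (\<Sum>m\<in>UNIV. \<Sum>l\<in>UNIV. (M $ k $ m * M' $ m $ l) *\<^sub>R ?G l)"
      by (simp add: tensor_transform_def[of M N] scaleR_sum_right)
    also have "\<dots> = (\<Sum>l\<in>UNIV. \<Sum>m\<in>UNIV. (M $ k $ m * M' $ m $ l) *\<^sub>R ?G l)"
      by (rule sum.swap)
    finally show ?thesis
      by (simp add: tensor_transform_def matrix_matrix_mult_def[of M] scaleR_sum_left)
  qed
  then show ?thesis by (simp add: vec_eq_iff)
qed

lemma tensor_transform_id: "tensor_transform (mat 1) (mat 1) \<Gamma> = \<Gamma>" for \<Gamma> :: "real^'n^'n^'n"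
proof -
  have "(\<Sum>m\<in>UNIV. (mat 1 :: real^'n^'n) $ k $ m *\<^sub>R \<Gamma> $ m) = (\<Sum>m\<in>UNIV. if k = m then \<Gamma> $ m else 0)" for k
    by (rule sum.cong) (auto simp: mat_def)
  then show ?thesis by (simp add: tensor_transform_def vec_eq_iff)
qed

text \<open>By adjointness \<open>transpose N\<close> moves across the inner product, so both
  lower-index contractions become the substitution of \<open>N *v v\<close> for
  \<open>v\<close>.\<close>

lemma quadratic_form_tensor_transform:
  "quadratic_form (tensor_transform M N \<Gamma>) v = M *v quadratic_form \<Gamma> (N *v v)"
proof -
  interpret l: bounded_linear "\<lambda>A. v \<bullet> (A *v v)"
    by (intro bounded_linear_compose[OF bounded_linear_inner_right]
        bounded_bilinear.bounded_linear_left[OF bounded_bilinear_matrix_vector_mult])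
  have "v \<bullet> ((transpose N ** B ** N) *v v) = (N *v v) \<bullet> (B *v (N *v v))" for B
    by (metis dot_lmul_matrix matrix_vector_mul_assoc vector_transpose_matrix transpose_transpose)
  then show ?thesis
    by (simp add: vec_eq_iff quadratic_form_def tensor_transform_def l.sum l.scaleR matrix_vector_mult_def[of M])
qed

lemma smooth_on_tensor_transform:
  assumes "open U" "smooth_on U M" "smooth_on U N" "smooth_on U \<Gamma>"
  shows "smooth_on U (\<lambda>x. tensor_transform (M x) (N x) (\<Gamma> x))"
  by (rule smooth_on_vec[OF assms(1)])
    (auto simp: tensor_transform_def intro!: assms smooth_on_sum smooth_on_bilinear[OF bounded_bilinear_scaleR]
      smooth_on_bilinear[OF bounded_bilinear_matrix_mult]
      smooth_on_linear[OF bounded_linear_transpose] smooth_on_nth)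

section \<open>Derivatives under a change of variables\<close>

text \<open>Freezing one variable is composition with an affine embedding of the line into the
  plane, so the partial derivative is the total derivative in a coordinate direction.\<close>

lemma deriv_slice:
  fixes f :: "real \<times> real \<Rightarrow> real^'n"
  assumes "(f has_derivative D) (at (t, x))"
  shows "deriv (\<lambda>\<tau>. f (\<tau>, x) $ i) t = D (1, 0) $ i"
    and "deriv (\<lambda>\<xi>. f (t, \<xi>) $ i) x = D (0, 1) $ i"
proof -
  have lin: "D (h *\<^sub>R v) = h *\<^sub>R D v" for h v
    using has_derivative_linear[OF assms] by (simp add: linear_cmul)
  have "((\<lambda>\<tau>. f (\<tau>, x) $ i) has_derivative (\<lambda>h. D (h, 0) $ i)) (at t)"
    by (rule bounded_linear.has_derivative[OF bounded_linear_vec_nth],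
        rule has_derivative_compose[where f = "\<lambda>\<tau>. (\<tau>, x)", OF _ assms])
      (auto intro!: derivative_eq_intros)
  moreover have "(\<lambda>h. D (h, 0) $ i) = (*) (D (1, 0) $ i)"
  proof
    show "D (h, 0) $ i = D (1, 0) $ i * h" for h
      using lin[of h "(1, 0)"] by simp
  qed
  ultimately show "deriv (\<lambda>\<tau>. f (\<tau>, x) $ i) t = D (1, 0) $ i"
    by (intro DERIV_imp_deriv) (simp add: has_field_derivative_def)
  have "((\<lambda>\<xi>. f (t, \<xi>) $ i) has_derivative (\<lambda>h. D (0, h) $ i)) (at x)"
    by (rule bounded_linear.has_derivative[OF bounded_linear_vec_nth],
        rule has_derivative_compose[where f = "\<lambda>\<xi>. (t, \<xi>)", OF _ assms])
      (auto intro!: derivative_eq_intros)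
  moreover have "(\<lambda>h. D (0, h) $ i) = (*) (D (0, 1) $ i)"
  proof
    show "D (0, h) $ i = D (0, 1) $ i * h" for h
      using lin[of h "(0, 1)"] by simp
  qed
  ultimately show "deriv (\<lambda>\<xi>. f (t, \<xi>) $ i) x = D (0, 1) $ i"
    by (intro DERIV_imp_deriv) (simp add: has_field_derivative_def)
qed

definition second_derivative :: "('a::euclidean_space \<Rightarrow> 'b::euclidean_space) \<Rightarrow> 'a \<Rightarrow> 'a \<Rightarrow> 'b" where
  "second_derivative f v p = frechet_derivative (\<lambda>q. frechet_derivative f (at q) v) (at p) v"

text \<open>The outer \<open>deriv\<close> looks at the inner one near \<open>x\<close>, so the
  slice formula is needed on a neighbourhood; openness of \<open>W\<close> provides it.\<close>

lemma deriv2_slice: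
  fixes f :: "real \<times> real \<Rightarrow> real^'n"
  assumes "open W" "smooth_on W f" "(t, x) \<in> W"
  shows "(deriv ^^ 2) (\<lambda>\<xi>. f (t, \<xi>) $ i) x = second_derivative f (0, 1) (t, x) $ i"
proof -
  have "open {\<xi>. (t, \<xi>) \<in> W}"
    using open_vimage[OF assms(1), of "Pair t"]
    by (simp add: vimage_def continuous_on_Pair)
  then have "\<forall>\<^sub>F \<xi> in nhds x. (t, \<xi>) \<in> W"
    using assms(3) eventually_nhds_in_open[of "{\<xi>. (t, \<xi>) \<in> W}" x] by simp
  then have "\<forall>\<^sub>F \<xi> in nhds x. deriv (\<lambda>\<xi>. f (t, \<xi>) $ i) \<xi> =
      frechet_derivative f (at (t, \<xi>)) (0, 1) $ i"
    by eventually_elim (rule deriv_slice(2)[OF smooth_on_has_derivative[OF assms(2)]])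
  then have "deriv (deriv (\<lambda>\<xi>. f (t, \<xi>) $ i)) x =
      deriv (\<lambda>\<xi>. frechet_derivative f (at (t, \<xi>)) (0, 1) $ i) x"
    by (rule deriv_cong_ev) simp
  also have "\<dots> = second_derivative f (0, 1) (t, x) $ i"
    unfolding second_derivative_def
    by (rule deriv_slice(2)[OF smooth_on_has_derivative[OF
            smooth_on_frechet_derivative[OF assms(2)] assms(3)]])
  finally show ?thesis by (simp add: numeral_2_eq_2)
qed

lemma system_holds_at_iff:
  assumes "open W" "smooth_on W y" "(t, x) \<in> W"
  shows "system_holds_at A \<Gamma> y t x \<longleftrightarrow>
    frechet_derivative y (at (t, x)) (1, 0) =
      A (y (t, x)) *v (second_derivative y (0, 1) (t, x) +
        quadratic_form (\<Gamma> (y (t, x))) (frechet_derivative y (at (t, x)) (0, 1)))"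
  unfolding system_holds_at_def deriv2_slice[OF assms]
    deriv_slice[OF smooth_on_has_derivative[OF assms(2,3)]]
  by (simp add: vec_eq_iff matrix_vector_mult_def quadratic_form_nth)

text \<open>The second partial derivatives of \<open>\<phi>\<close>, indexed like
  \<open>\<Gamma>\<close> so that \<open>quadratic_form\<close> and \<open>tensor_transform\<close>
  apply; the last index is the one of the outer differentiation.\<close>

definition jacobian_gradient :: "(real^'n \<Rightarrow> real^'n) \<Rightarrow> real^'n \<Rightarrow> real^'n^'n^'n" where
  "jacobian_gradient \<phi> y = (\<chi> m i j. pderiv_at (\<lambda>z. jacobian \<phi> (at z) $ m $ i) j y)"

lemma jacobian_nth: "jacobian \<phi> (at y) $ i $ j = frechet_derivative \<phi> (at y) (axis j 1) $ i"
  for \<phi> :: "real^'n \<Rightarrow> real^'m"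
  by (simp add: jacobian_def matrix_def)

lemma smooth_on_jacobian:
  fixes \<phi> :: "real^'n \<Rightarrow> real^'m"
  assumes "open U" "smooth_on U \<phi>"
  shows "smooth_on U (\<lambda>y. jacobian \<phi> (at y))"
proof (intro smooth_on_vec[OF assms(1)])
  show "smooth_on U (\<lambda>y. jacobian \<phi> (at y) $ i $ j)" for i j
    unfolding jacobian_nth
    by (intro smooth_on_nth smooth_on_frechet_derivative assms)
qed

lemma smooth_on_jacobian_gradient:
  assumes "open U" "smooth_on U \<phi>"
  shows "smooth_on U (jacobian_gradient \<phi>)"
proof (intro smooth_on_vec[OF assms(1)])
  show "smooth_on U (\<lambda>y. jacobian_gradient \<phi> y $ m $ i $ j)" for m i j
    unfolding jacobian_gradient_def pderiv_at_def
    by (simp, intro smooth_on_frechet_derivative smooth_on_nth smooth_on_jacobian assms)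
qed

lemma jacobian_has_derivative:
  "smooth_on U \<phi> \<Longrightarrow> y \<in> U \<Longrightarrow> (\<phi> has_derivative (*v) (jacobian \<phi> (at y))) (at y)"
  for \<phi> :: "real^'n \<Rightarrow> real^'m"
  using smooth_on_has_derivative[of U \<phi> y] jacobian_works[of \<phi> "at y"]
  by (auto simp: differentiable_def)

text \<open>The direction of differentiation is expanded in the axis vectors. The same
  \<open>v\<close> is also the vector the matrix acts on, so the result is quadratic in
  \<open>v\<close>.\<close>

lemma frechet_derivative_jacobian_mult:
  assumes "open U" "smooth_on U \<phi>" "y \<in> U"
  shows "frechet_derivative (\<lambda>z. jacobian \<phi> (at z)) (at y) v *v v =
    quadratic_form (jacobian_gradient \<phi> y) v"
proof -
  let ?J = "\<lambda>z. jacobian \<phi> (at z)"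
  let ?D = "frechet_derivative ?J (at y)"
  have J: "(?J has_derivative ?D) (at y)"
    by (rule smooth_on_has_derivative[OF smooth_on_jacobian[OF assms(1,2)] assms(3)])
  have "frechet_derivative (\<lambda>z. ?J z $ m $ i) (at y) = (\<lambda>h. ?D h $ m $ i)" for m i
    by (rule frechet_derivative_at[symmetric])
      (intro bounded_linear.has_derivative[OF bounded_linear_vec_nth] J)
  then have grad: "jacobian_gradient \<phi> y $ m $ i $ j = ?D (axis j 1) $ m $ i" for m i j
    by (simp add: jacobian_gradient_def pderiv_at_def)
  interpret D: linear ?D by (rule has_derivative_linear[OF J])
  have "(\<Sum>j\<in>UNIV. v $ j *\<^sub>R axis j 1) = v"
    by (simp add: basis_expansion flip: scalar_mult_eq_scaleR)
  then have "?D v = ?D (\<Sum>j\<in>UNIV. v $ j *\<^sub>R axis j 1)"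
    by (rule arg_cong[OF sym])
  also have "\<dots> = (\<Sum>j\<in>UNIV. v $ j *\<^sub>R ?D (axis j 1))"
    by (simp only: D.sum D.scaleR)
  finally show ?thesis
    by (simp add: vec_eq_iff matrix_vector_mult_def quadratic_form_nth grad sum_distrib_left
        sum_distrib_right mult_ac)
qed

section \<open>First and second order chain rules for \<open>\<phi> \<circ> y\<close>\<close>

lemma frechet_derivative_change_of_variables:
  fixes \<phi> :: "real^'n \<Rightarrow> real^'m"
  assumes "smooth_on U \<phi>" "smooth_on W y" "y ` W \<subseteq> U" "p \<in> W"
  shows "frechet_derivative (\<phi> \<circ> y) (at p) v =
    jacobian \<phi> (at (y p)) *v frechet_derivative y (at p) v"
proof -
  have "y p \<in> U" using assms by auto
  then have "((\<phi> \<circ> y) has_derivative (*v) (jacobian \<phi> (at (y p))) \<circ> frechet_derivative y (at p)) (at p)"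
    using assms by (intro diff_chain_at smooth_on_has_derivative jacobian_has_derivative)
  from frechet_derivative_at[OF this] show ?thesis by (metis comp_apply)
qed

text \<open>The first order rule holds throughout the open set \<open>W\<close>, so it may be
  differentiated again with the product rule. The derivative falling on the Jacobian produces the
  quadratic term.\<close>

lemma second_derivative_change_of_variables:
  assumes "open U" "open W" "smooth_on U \<phi>" "smooth_on W y" "y ` W \<subseteq> U" "p \<in> W"
  shows "second_derivative (\<phi> \<circ> y) v p = jacobian \<phi> (at (y p)) *v second_derivative y v p +
    quadratic_form (jacobian_gradient \<phi> (y p)) (frechet_derivative y (at p) v)"
proof -
  let ?J = "\<lambda>z. jacobian \<phi> (at z)"
  have yp: "y p \<in> U" using assms by auto
  note J = smooth_on_has_derivative[OF smooth_on_jacobian[OF assms(1,3)] yp]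
  note Jy = has_derivative_compose[OF smooth_on_has_derivative[OF assms(4,6)] J]
  note yv = smooth_on_has_derivative[OF smooth_on_frechet_derivative[OF assms(4)] assms(6)]
  have "((\<lambda>q. ?J (y q) *v frechet_derivative y (at q) v) has_derivative
      (\<lambda>h. ?J (y p) *v frechet_derivative (\<lambda>q. frechet_derivative y (at q) v) (at p) h +
        frechet_derivative ?J (at (y p)) (frechet_derivative y (at p) h) *v
          frechet_derivative y (at p) v)) (at p)" (is "(_ has_derivative ?D) _")
    by (rule bounded_bilinear.FDERIV[OF bounded_bilinear_matrix_vector_mult Jy yv])
  then have "((\<lambda>q. frechet_derivative (\<phi> \<circ> y) (at q) v) has_derivative ?D) (at p)"
    by (rule has_derivative_transform_within_open[OF _ assms(2,6)])
      (simp add: frechet_derivative_change_of_variables[OF assms(3,4,5)])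
  from frechet_derivative_at[OF this, symmetric] show ?thesis
    by (simp add: second_derivative_def frechet_derivative_jacobian_mult[OF assms(1,3) yp])
qed

text \<open>Differentiates the identity \<open>\<psi> \<circ> \<phi> = id\<close>, valid on the open
  set \<open>U\<close>, and compares the two derivatives by uniqueness.\<close>

lemma jacobian_inverse:
  assumes "change_of_variables U V \<phi> \<psi>" "y \<in> U"
  shows "jacobian \<psi> (at (\<phi> y)) ** jacobian \<phi> (at y) = mat 1"
proof -
  have "open U" "smooth_on U \<phi>" "smooth_on V \<psi>" "\<phi> y \<in> V" "\<And>z. z \<in> U \<Longrightarrow> \<psi> (\<phi> z) = z"
    using assms by (auto simp: change_of_variables_def homeomorphism_def)
  note \<phi> = this
  have "((\<psi> \<circ> \<phi>) has_derivative (*v) (jacobian \<psi> (at (\<phi> y))) \<circ> (*v) (jacobian \<phi> (at y))) (at y)"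
    by (intro diff_chain_at jacobian_has_derivative[OF \<phi>(2) assms(2)]
        jacobian_has_derivative[OF \<phi>(3,4)])
  moreover have "((\<psi> \<circ> \<phi>) has_derivative (\<lambda>h. h)) (at y)"
    by (rule has_derivative_transform_within_open[OF has_derivative_ident \<phi>(1) assms(2)])
      (simp add: \<phi>(5))
  ultimately have "(*v) (jacobian \<psi> (at (\<phi> y))) \<circ> (*v) (jacobian \<phi> (at y)) = (\<lambda>h. h)"
    by (rule has_derivative_unique)
  then show ?thesis
    by (simp add: fun_eq_iff matrix_vector_mul_assoc matrix_eq)
qed

section \<open>The transformed coefficients and the equivalence of the two systems\<close>

theorem theorem1p1:
  fixes U V :: "(real^'n) set"
    and \<phi> \<psi> :: "real^'n \<Rightarrow> real^'n"
    and A S T :: "real^'n \<Rightarrow> real^'n^'n"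
    and \<Gamma> :: "real^'n \<Rightarrow> real^'n^'n^'n"
  assumes "change_of_variables U V \<phi> \<psi>"
    and "admissible_coefficients U A \<Gamma>"
    and S_def: "\<And>y'. S y' = jacobian \<psi> (at y')"
    and T_def: "\<And>y. T y = jacobian \<phi> (at y)"
  shows "\<exists>A' \<Gamma>'.
    admissible_coefficients V A' \<Gamma>' \<and>
    system_transfers U \<phi> A \<Gamma> A' \<Gamma>' \<and>
    (\<forall>y\<in>U. \<forall>k i. A y $ k $ i =
      (\<Sum>m\<in>UNIV. \<Sum>p\<in>UNIV. S (\<phi> y) $ k $ m * T y $ p $ i * A' (\<phi> y) $ m $ p)) \<and>
    (\<forall>y\<in>U. \<forall>k i j. \<Gamma> y $ k $ i $ j =
      (\<Sum>m\<in>UNIV. \<Sum>p\<in>UNIV. \<Sum>q\<in>UNIV.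
         S (\<phi> y) $ k $ m * T y $ p $ i * T y $ q $ j * \<Gamma>' (\<phi> y) $ m $ p $ q) +
      (\<Sum>m\<in>UNIV. S (\<phi> y) $ k $ m * pderiv_at (\<lambda>z. T z $ m $ i) j y))"
proof -
  have open_UV: "open U" "open V" and smooth: "smooth_on U \<phi>" "smooth_on V \<psi>"
    and \<psi>U: "\<psi> ` V \<subseteq> U"
    and \<psi>\<phi>: "\<And>y. y \<in> U \<Longrightarrow> \<psi> (\<phi> y) = y" and \<phi>\<psi>: "\<And>z. z \<in> V \<Longrightarrow> \<phi> (\<psi> z) = z"
    using assms(1) by (auto simp: change_of_variables_def homeomorphism_def)
  have smooth_A: "smooth_on U A" and smooth_\<Gamma>: "smooth_on U \<Gamma>"
    and det_A: "\<And>y. y \<in> U \<Longrightarrow> det (A y) \<noteq> 0"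
    using assms(2) by (auto simp: admissible_coefficients_def)
  have ST: "S (\<phi> y) ** T y = mat 1" if "y \<in> U" for y
    unfolding S_def T_def by (rule jacobian_inverse[OF assms(1) that])
  then have TS: "T y ** S (\<phi> y) = mat 1" if "y \<in> U" for y
    using that matrix_left_right_inverse by blast
  let ?D = "jacobian_gradient \<phi>"
  \<comment> \<open>The relation A = S A' T is solved for A' with the inverses T and S; composing
    with \<open>\<psi>\<close> makes the result a function of the new variable.\<close>
  define A' where "A' z = T (\<psi> z) ** A (\<psi> z) ** S z" for z
  \<comment> \<open>The inhomogeneous term is subtracted first; then the tensorial part is inverted
    by exchanging the roles of S and T.\<close>
  define \<Gamma>' where
    "\<Gamma>' z = tensor_transform (T (\<psi> z)) (S z) (\<Gamma> (\<psi> z) - tensor_transform (S z) (mat 1) (?D (\<psi> z)))" for z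
  have smooth_S: "smooth_on V S" and smooth_T: "smooth_on U T"
    using smooth_on_jacobian open_UV smooth by (auto simp: S_def[abs_def] T_def[abs_def])
  have T\<psi>: "smooth_on V (\<lambda>z. T (\<psi> z))"
    by (rule smooth_on_compose[OF open_UV(2) smooth(2) smooth_T \<psi>U])
  have A\<psi>: "smooth_on V (\<lambda>z. A (\<psi> z))"
    by (rule smooth_on_compose[OF open_UV(2) smooth(2) smooth_A \<psi>U])
  have \<Gamma>\<psi>: "smooth_on V (\<lambda>z. \<Gamma> (\<psi> z))"
    by (rule smooth_on_compose[OF open_UV(2) smooth(2) smooth_\<Gamma> \<psi>U])
  have D\<psi>: "smooth_on V (\<lambda>z. ?D (\<psi> z))"
    by (rule smooth_on_compose[OF open_UV(2) smooth(2)
          smooth_on_jacobian_gradient[OF open_UV(1) smooth(1)] \<psi>U])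
  have "smooth_on V A'"
    unfolding A'_def[abs_def]
    by (intro smooth_on_bilinear[OF bounded_bilinear_matrix_mult] open_UV T\<psi> A\<psi> smooth_S)
  moreover have "smooth_on V \<Gamma>'"
    unfolding \<Gamma>'_def[abs_def]
    by (intro smooth_on_tensor_transform smooth_on_minus smooth_on_const open_UV T\<psi> \<Gamma>\<psi> D\<psi> smooth_S)
  moreover have "det (A' z) \<noteq> 0" if "z \<in> V" for z
  proof -
    have z: "\<psi> z \<in> U" using \<psi>U that by auto
    have "det (S z) * det (T (\<psi> z)) = 1"
      using ST[OF z] \<phi>\<psi>[OF that] by (metis det_I det_mul)
    then show ?thesis using det_A[OF z] by (auto simp: A'_def det_mul)
  qed
  ultimately have adm: "admissible_coefficients V A' \<Gamma>'"
    by (simp add: admissible_coefficients_def)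
  have A_eq: "A y = S (\<phi> y) ** A' (\<phi> y) ** T y" if "y \<in> U" for y
  proof -
    have "S (\<phi> y) ** A' (\<phi> y) ** T y = (S (\<phi> y) ** T y) ** A y ** (S (\<phi> y) ** T y)"
      by (simp add: A'_def \<psi>\<phi>[OF that] matrix_mul_assoc)
    then show ?thesis by (simp add: ST[OF that])
  qed
  have \<Gamma>_eq: "\<Gamma> y = tensor_transform (S (\<phi> y)) (T y) (\<Gamma>' (\<phi> y)) +
      tensor_transform (S (\<phi> y)) (mat 1) (?D y)"
    if "y \<in> U" for y
    by (simp add: \<Gamma>'_def \<psi>\<phi>[OF that] tensor_transform_comp ST[OF that] tensor_transform_id)
  have "system_holds_at A \<Gamma> y t x \<longleftrightarrow> system_holds_at A' \<Gamma>' (\<phi> \<circ> y) t x"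
    if W: "open W" "smooth_on W y" "y ` W \<subseteq> U" and tx: "(t, x) \<in> W" for W y t x
  proof -
    let ?p = "(t, x)"
    let ?yt = "frechet_derivative y (at ?p) (1, 0)"
    let ?yx = "frechet_derivative y (at ?p) (0, 1)"
    let ?yxx = "second_derivative y (0, 1) ?p"
    let ?S = "S (\<phi> (y ?p))" and ?T = "T (y ?p)" and ?A' = "A' (\<phi> (y ?p))"
    \<comment> \<open>This is the bracket of the new system for u = \<open>\<phi> \<circ> y\<close>:
      the first two summands are u_xx, and T y_x is u_x.\<close>
    let ?r = "?T *v ?yxx + quadratic_form (?D (y ?p)) ?yx +
      quadratic_form (\<Gamma>' (\<phi> (y ?p))) (?T *v ?yx)"
    have yp: "y ?p \<in> U" using W(3) tx by auto
    have "smooth_on W (\<phi> \<circ> y)"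
      using smooth_on_compose[OF W(1,2) smooth(1) W(3)] by (simp add: comp_def)
    from system_holds_at_iff[OF W(1) this tx]
    have new: "system_holds_at A' \<Gamma>' (\<phi> \<circ> y) t x \<longleftrightarrow> ?T *v ?yt = ?A' *v ?r"
      by (simp add: T_def frechet_derivative_change_of_variables[OF smooth(1) W(2,3) tx]
          second_derivative_change_of_variables[OF open_UV(1) W(1) smooth(1) W(2,3) tx])
    \<comment> \<open>Applying S to \<open>?r\<close> cancels T in front of y_xx and turns the two
      quadratic terms into the two parts of \<open>\<Gamma>\<close> in
      \<open>\<Gamma>_eq\<close>.\<close>
    have "?yxx + quadratic_form (\<Gamma> (y ?p)) ?yx = ?S *v ?r"
      by (simp add: \<Gamma>_eq[OF yp] quadratic_form_add quadratic_form_tensor_transform matrix_vector_right_distrib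
          matrix_vector_mul_assoc ST[OF yp])
    \<comment> \<open>With A = S A' T the factor T meets the S in front of \<open>?r\<close>; the
      product is kept bracketed so that T S = 1 removes it next.\<close>
    then have "A (y ?p) *v (?yxx + quadratic_form (\<Gamma> (y ?p)) ?yx) =
        (?S ** ?A' ** (?T ** ?S)) *v ?r"
      by (simp add: A_eq[OF yp] matrix_vector_mul_assoc matrix_mul_assoc)
    then have "A (y ?p) *v (?yxx + quadratic_form (\<Gamma> (y ?p)) ?yx) = ?S *v (?A' *v ?r)"
      by (simp add: TS[OF yp] matrix_vector_mul_assoc)
    then have "system_holds_at A \<Gamma> y t x \<longleftrightarrow> ?yt = ?S *v (?A' *v ?r)"
      by (simp add: system_holds_at_iff[OF W(1,2) tx])
    also have "\<dots> \<longleftrightarrow> ?T *v ?yt = ?A' *v ?r"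
    proof
      show "?T *v ?yt = ?A' *v ?r" if "?yt = ?S *v (?A' *v ?r)"
        unfolding that by (simp only: matrix_vector_mul_assoc[of ?T ?S] TS[OF yp] matrix_vector_mul_lid)
      show "?yt = ?S *v (?A' *v ?r)" if "?T *v ?yt = ?A' *v ?r"
        unfolding that[symmetric]
        by (simp only: matrix_vector_mul_assoc[of ?S ?T] ST[OF yp] matrix_vector_mul_lid)
    qed
    finally show ?thesis using new by simp
  qed
  then have transfer: "system_transfers U \<phi> A \<Gamma> A' \<Gamma>'"
    unfolding system_transfers_def by blast
  have "A y $ k $ i =
      (\<Sum>m\<in>UNIV. \<Sum>p\<in>UNIV. S (\<phi> y) $ k $ m * T y $ p $ i * A' (\<phi> y) $ m $ p)"
    if "y \<in> U" for y k i
  proof -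
    \<comment> \<open>Unfolding the left-nested product S A' T puts the sum over \<open>p\<close>
      outside, hence the exchange of sums afterwards.\<close>
    have "A y $ k $ i =
        (\<Sum>p\<in>UNIV. \<Sum>m\<in>UNIV. S (\<phi> y) $ k $ m * T y $ p $ i * A' (\<phi> y) $ m $ p)"
      by (subst A_eq[OF that]) (simp add: matrix_matrix_mult_def sum_distrib_left sum_distrib_right mult_ac)
    also have "\<dots> = (\<Sum>m\<in>UNIV. \<Sum>p\<in>UNIV. S (\<phi> y) $ k $ m * T y $ p $ i * A' (\<phi> y) $ m $ p)"
      by (rule sum.swap)
    finally show ?thesis .
  qed
  moreover have "\<Gamma> y $ k $ i $ j =
      (\<Sum>m\<in>UNIV. \<Sum>p\<in>UNIV. \<Sum>q\<in>UNIV.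
         S (\<phi> y) $ k $ m * T y $ p $ i * T y $ q $ j * \<Gamma>' (\<phi> y) $ m $ p $ q) +
      (\<Sum>m\<in>UNIV. S (\<phi> y) $ k $ m * pderiv_at (\<lambda>z. T z $ m $ i) j y)"
    if "y \<in> U" for y k i j
    by (subst \<Gamma>_eq[OF that])
      (simp only: vector_add_component tensor_transform_mat1_nth,
        simp add: tensor_transform_nth jacobian_gradient_def T_def)
  ultimately show ?thesis using adm transfer by blast
qed

end
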